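(* Let $E$ be a normed space, let $f\colon E\to E$, let $1\le p\le q<+\infty$ and $\frac pq\le\alpha\le1$. Assume that the composition operator $C_f$ maps $l^p(E)$ into $bv_q(E)$. Then $C_f\colon l^p(E)\to bv_q(E)$ is Hölder continuous on bounded sets with exponent $\alpha$ if and only if $f$ is Hölder continuous on bounded sets with exponent $\alpha$.
   Context: $E$ is a normed space over $\mathbb R$ or $\mathbb C$ with norm $\|\cdot\|$. For a map $f\colon E\to E$, the composition operator $C_f$ assigns to a sequence $x\colon\mathbb N\to E$ the sequence $C_f(x)$ with $C_f(x)(n)=f(x(n))$ for all $n\in\mathbb N$. $l^p(E)$ is the space of sequences $x\colon\mathbb N\to E$ with $\|x\|_{l^p}=\bigl(\sum_{n=1}^\infty\|x(n)\|^p\bigr)^{1/p}<+\infty$. $bv_q(E)$ is the space of all sequences $x\colon\mathbb N\to E$ with $\sum_{n=1}^\infty\|x(n+1)-x(n)\|^q<+\infty$, with norm $\|x\|_{bv_q}=\|x(1)\|+\bigl(\sum_{n=1}^\infty\|x(n+1)-x(n)\|^q\bigr)^{1/q}$. A map $F\colon X\to Y$ between normed spaces is Hölder continuous on bounded sets with exponent $\alpha\in(0,1]$ if for every $r>0$ there exists $L_r\ge0$ such that $\|F(x)-F(y)\|_Y\le L_r\|x-y\|_X^\alpha$ for all $x,y$ in the closed ball of $X$ with center $0$ and radius $r$. *)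

theory Defs
  imports Complex_Main "HOL-Library.FuncSet"
begin

(* Sequences are indexed from 0, so x 0 is the first term. The scalar field plays no
   role in any of the notions below; a complex normed space is covered as the real
   normed space obtained by restriction of scalars. *)

definition lp_space :: "real \<Rightarrow> (nat \<Rightarrow> 'a::real_normed_vector) set" where
  "lp_space p = {x. summable (\<lambda>n. norm (x n) powr p)}"

definition lp_norm :: "real \<Rightarrow> (nat \<Rightarrow> 'a::real_normed_vector) \<Rightarrow> real" where
  "lp_norm p x = (\<Sum>n. norm (x n) powr p) powr (1 / p)"

definition bv_space :: "real \<Rightarrow> (nat \<Rightarrow> 'a::real_normed_vector) set" where
  "bv_space q = {x. summable (\<lambda>n. norm (x (Suc n) - x n) powr q)}"

definition bv_norm :: "real \<Rightarrow> (nat \<Rightarrow> 'a::real_normed_vector) \<Rightarrow> real" where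
  "bv_norm q x = norm (x 0) + (\<Sum>n. norm (x (Suc n) - x n) powr q) powr (1 / q)"

definition comp_op :: "('a \<Rightarrow> 'b) \<Rightarrow> (nat \<Rightarrow> 'a) \<Rightarrow> (nat \<Rightarrow> 'b)" where
  "comp_op f x = (\<lambda>n. f (x n))"

(* The normed spaces are given by carriers X, Y with norms nX, nY, since l^p and bv_q
   depend on a real parameter and are not types. On sequences, subtraction is pointwise
   (fun_diff_def). *)
definition holder_on_bounded_sets ::
    "'a::minus set \<Rightarrow> ('a \<Rightarrow> real) \<Rightarrow> 'b::minus set \<Rightarrow> ('b \<Rightarrow> real) \<Rightarrow> real \<Rightarrow> ('a \<Rightarrow> 'b) \<Rightarrow> bool" where
  "holder_on_bounded_sets X nX Y nY \<alpha> F \<longleftrightarrow>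
     F \<in> X \<rightarrow> Y \<and> 0 < \<alpha> \<and> \<alpha> \<le> 1 \<and>
     (\<forall>r>0. \<exists>L\<ge>0. \<forall>x\<in>X. \<forall>y\<in>X. nX x \<le> r \<longrightarrow> nX y \<le> r \<longrightarrow>
        nY (F x - F y) \<le> L * nX (x - y) powr \<alpha>)"

end

theory Submission imports Defs begin

text \<open>
  If \<open>C\<^sub>f\<close> is Hoelder, test it on the sequences \<open>(u, 0, 0, \<dots>)\<close>: they embed \<open>E\<close> isometrically
  into \<open>l\<^sup>p\<close>, and the first term of a sequence is controlled by its \<open>bv\<^sub>q\<close> norm.
  Conversely, the terms of a sequence are bounded by its \<open>l\<^sup>p\<close> norm, so the Hoelder estimate for
  \<open>f\<close> applies termwise. Since \<open>\<alpha> q \<ge> p\<close>, the \<open>\<alpha> q\<close>-th powers of the terms of \<open>w = x - y\<close>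
  sum to at most \<open>\<parallel>w\<parallel>\<^sub>p\<close> to the power \<open>\<alpha> q\<close>; and the \<open>bv\<^sub>q\<close> norm is dominated by a
  multiple of the \<open>l\<^sup>q\<close> norm.
\<close>

text \<open>Bounding \<open>a + b\<close> by twice the maximum avoids convexity, so the estimate
  covers every exponent \<open>s\<close> that is nonnegative, at the price of a non-optimal
  constant.\<close>

lemma powr_add_le:
  fixes a b s :: real
  assumes "0 \<le> a" "0 \<le> b" "0 \<le> s"
  shows "(a + b) powr s \<le> 2 powr s * (a powr s + b powr s)"
proof -
  have "(a + b) powr s \<le> (2 * max a b) powr s"
    using assms by (intro powr_mono2) auto
  also have "\<dots> = 2 powr s * max a b powr s"
    using assms by (simp add: powr_mult)
  also have "\<dots> \<le> 2 powr s * (a powr s + b powr s)"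
    by (intro mult_left_mono) (auto simp: max_def)
  finally show ?thesis .
qed

lemma norm_diff_powr_le:
  fixes a b :: "'a::real_normed_vector"
  assumes "0 \<le> s"
  shows "norm (a - b) powr s \<le> 2 powr s * (norm a powr s + norm b powr s)"
proof -
  have "norm (a - b) powr s \<le> (norm a + norm b) powr s"
    using assms by (intro powr_mono2 norm_triangle_ineq4) auto
  also have "\<dots> \<le> 2 powr s * (norm a powr s + norm b powr s)"
    using assms by (intro powr_add_le) auto
  finally show ?thesis .
qed

lemma lp_space_diff:
  assumes "0 \<le> p" "x \<in> lp_space p" "y \<in> lp_space p"
  shows "x - y \<in> lp_space p"
proof -
  have "summable (\<lambda>n. 2 powr p * (norm (x n) powr p + norm (y n) powr p))"
    using assms by (intro summable_mult summable_add) (auto simp: lp_space_def)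
  then have "summable (\<lambda>n. norm (x n - y n) powr p)"
    by (rule summable_comparison_test') (use assms norm_diff_powr_le in auto)
  then show ?thesis
    by (simp add: lp_space_def)
qed

lemma lp_norm_nonneg: "0 \<le> lp_norm p x"
  by (simp add: lp_norm_def)

lemma lp_norm_powr:
  assumes "0 < p" "x \<in> lp_space p"
  shows "lp_norm p x powr p = (\<Sum>n. norm (x n) powr p)"
  using assms by (simp add: lp_norm_def lp_space_def powr_powr suminf_nonneg)

lemma norm_le_lp_norm:
  assumes "0 < p" "x \<in> lp_space p"
  shows "norm (x n) \<le> lp_norm p x"
proof -
  \<comment> \<open>A single term is the partial sum over \<open>{n}\<close>, and the summands are
    nonnegative.\<close>
  have "(\<Sum>i\<in>{n}. norm (x i) powr p) \<le> (\<Sum>i. norm (x i) powr p)"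
    using assms by (intro sum_le_suminf) (auto simp: lp_space_def)
  then have "(norm (x n) powr p) powr (1/p) \<le> lp_norm p x"
    unfolding lp_norm_def using assms by (intro powr_mono2) auto
  then show ?thesis
    using assms by (simp add: powr_powr)
qed

lemma lp_single:
  fixes u :: "'a::real_normed_vector"
  assumes "0 < p"
  shows "(\<lambda>n. if n = 0 then u else 0) \<in> lp_space p"
    and "lp_norm p (\<lambda>n. if n = 0 then u else 0) = norm u"
proof -
  have "(\<lambda>n. norm (if n = 0 then u else 0) powr p) sums (norm u powr p)"
    \<comment> \<open>\<open>sums_single\<close> has the conditional outside the power; the two
      forms agree because \<open>0 powr p = 0\<close>.\<close>
    by (rule sums_single[of 0 "\<lambda>_. norm u powr p", THEN sums_cong[THEN iffD1, rotated]]) simp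
  then show "(\<lambda>n. if n = 0 then u else 0) \<in> lp_space p"
    and "lp_norm p (\<lambda>n. if n = 0 then u else 0) = norm u"
    using assms by (auto simp: lp_space_def lp_norm_def sums_iff powr_powr)
qed

text \<open>Each term is at most the \<open>p\<close>-norm, so the surplus power
  \<open>s - p\<close> can be pulled out of the sum as a constant; what remains is the sum of
  \<open>p\<close>-th powers.\<close>

lemma lp_sum_powr_le:
  assumes "0 < p" "p \<le> s" "x \<in> lp_space p"
  shows "summable (\<lambda>n. norm (x n) powr s)"
    and "(\<Sum>n. norm (x n) powr s) \<le> lp_norm p x powr s"
proof -
  have le: "norm (x n) powr s \<le> lp_norm p x powr (s - p) * norm (x n) powr p" for n
  proof -
    have "norm (x n) powr s = norm (x n) powr (s - p) * norm (x n) powr p"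
      by (simp flip: powr_add)
    also have "\<dots> \<le> lp_norm p x powr (s - p) * norm (x n) powr p"
      using assms norm_le_lp_norm by (intro mult_right_mono powr_mono2) auto
    finally show ?thesis .
  qed
  have sum: "summable (\<lambda>n. lp_norm p x powr (s - p) * norm (x n) powr p)"
    using assms by (intro summable_mult) (simp add: lp_space_def)
  then show summ: "summable (\<lambda>n. norm (x n) powr s)"
    by (rule summable_comparison_test') (use le in auto)
  have "(\<Sum>n. norm (x n) powr s) \<le> (\<Sum>n. lp_norm p x powr (s - p) * norm (x n) powr p)"
    using le summ sum by (intro suminf_le) auto
  also have "\<dots> = lp_norm p x powr (s - p) * lp_norm p x powr p"
    using assms by (simp add: suminf_mult lp_norm_powr lp_space_def)
  also have "\<dots> = lp_norm p x powr s"
    by (simp flip: powr_add)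
  finally show "(\<Sum>n. norm (x n) powr s) \<le> lp_norm p x powr s" .
qed

lemma norm_le_bv_norm: "norm (x 0) \<le> bv_norm q x"
  by (simp add: bv_norm_def)

text \<open>The 1 in the constant pays for the first term. For the differences,
  \<open>norm_diff_powr_le\<close> costs \<open>2 powr q\<close> and the two sums cost 2; the
  \<open>q\<close>-th root of this product is \<open>2 * 2 powr (1/q)\<close>. This crude bound
  replaces Minkowski's inequality.\<close>

lemma bv_norm_le_lp_norm:
  assumes "0 < q" "x \<in> lp_space q"
  shows "bv_norm q x \<le> (1 + 2 * 2 powr (1/q)) * lp_norm q x"
proof -
  have summ: "summable (\<lambda>n. norm (x n) powr q)"
    using assms by (simp add: lp_space_def)
  then have summ_Suc: "summable (\<lambda>n. norm (x (Suc n)) powr q)"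
    by (subst summable_Suc_iff)
  have le: "norm (x (Suc n) - x n) powr q \<le> 2 powr q * (norm (x (Suc n)) powr q + norm (x n) powr q)"
    for n
    using assms by (intro norm_diff_powr_le) auto
  have summ_bound: "summable (\<lambda>n. 2 powr q * (norm (x (Suc n)) powr q + norm (x n) powr q))"
    using summ summ_Suc by (intro summable_mult summable_add)
  then have summ_diff: "summable (\<lambda>n. norm (x (Suc n) - x n) powr q)"
    by (rule summable_comparison_test') (use le in auto)
  have "(\<Sum>n. norm (x (Suc n) - x n) powr q)
      \<le> (\<Sum>n. 2 powr q * (norm (x (Suc n)) powr q + norm (x n) powr q))"
    using le summ_diff summ_bound by (intro suminf_le) auto
  also have "\<dots> = 2 powr q * ((\<Sum>n. norm (x (Suc n)) powr q) + (\<Sum>n. norm (x n) powr q))"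
    using summ summ_Suc by (simp add: suminf_mult suminf_add summable_add)
  \<comment> \<open>The shifted sum is the full sum without its nonnegative head.\<close>
  also have "\<dots> \<le> 2 powr q * (2 * (\<Sum>n. norm (x n) powr q))"
    using suminf_split_head[OF summ] by (intro mult_left_mono) auto
  also have "\<dots> = 2 powr q * (2 * lp_norm q x powr q)"
    using assms by (simp add: lp_norm_powr)
  finally have "(\<Sum>n. norm (x (Suc n) - x n) powr q) powr (1/q)
      \<le> (2 powr q * (2 * lp_norm q x powr q)) powr (1/q)"
    using assms summ_diff by (intro powr_mono2) (auto intro: suminf_nonneg)
  also have "\<dots> = 2 * 2 powr (1/q) * lp_norm q x"
    using assms by (simp add: powr_mult powr_powr lp_norm_nonneg)
  finally show ?thesis
    using norm_le_lp_norm[OF assms, of 0] by (simp add: bv_norm_def algebra_simps)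
qed

text \<open>A termwise Hoelder bound passes to the norms: the \<open>q\<close>-th power of the bound
  has exponent \<open>\<alpha> * q\<close>, which is at least \<open>p\<close>, so
  \<open>lp_sum_powr_le\<close> applies. It is used with \<open>d\<close> the difference of the
  images and \<open>w\<close> that of the arguments.\<close>

lemma lp_norm_holder_le:
  fixes d :: "nat \<Rightarrow> 'b::real_normed_vector" and w :: "nat \<Rightarrow> 'a::real_normed_vector"
  assumes "0 < p" "0 < q" "p \<le> \<alpha> * q" "0 \<le> L" "w \<in> lp_space p"
    and le: "\<And>n. norm (d n) \<le> L * norm (w n) powr \<alpha>"
  shows "d \<in> lp_space q" and "lp_norm q d \<le> L * lp_norm p w powr \<alpha>"
proof -
  note w = lp_sum_powr_le[OF \<open>0 < p\<close> \<open>p \<le> \<alpha> * q\<close> \<open>w \<in> lp_space p\<close>]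
  have le_q: "norm (d n) powr q \<le> L powr q * norm (w n) powr (\<alpha> * q)" for n
  proof -
    have "norm (d n) powr q \<le> (L * norm (w n) powr \<alpha>) powr q"
      using assms by (intro powr_mono2) auto
    then show ?thesis
      using assms by (simp add: powr_mult powr_powr)
  qed
  have summ_bound: "summable (\<lambda>n. L powr q * norm (w n) powr (\<alpha> * q))"
    using w by (intro summable_mult)
  then have summ: "summable (\<lambda>n. norm (d n) powr q)"
    by (rule summable_comparison_test') (use le_q in auto)
  then show "d \<in> lp_space q"
    by (simp add: lp_space_def)
  have "(\<Sum>n. norm (d n) powr q) \<le> (\<Sum>n. L powr q * norm (w n) powr (\<alpha> * q))"
    using le_q summ summ_bound by (intro suminf_le) auto
  also have "\<dots> \<le> L powr q * lp_norm p w powr (\<alpha> * q)"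
    using w by (simp add: suminf_mult mult_left_mono)
  finally have "lp_norm q d \<le> (L powr q * lp_norm p w powr (\<alpha> * q)) powr (1/q)"
    unfolding lp_norm_def[of q d] using assms summ
    by (intro powr_mono2) (auto intro: suminf_nonneg)
  also have "\<dots> = L * lp_norm p w powr \<alpha>"
    using assms by (simp add: powr_mult powr_powr)
  finally show "lp_norm q d \<le> L * lp_norm p w powr \<alpha>" .
qed

theorem theorem31:
  fixes f :: "'a::real_normed_vector \<Rightarrow> 'a" and p q \<alpha> :: real
  assumes "1 \<le> p" and "p \<le> q" and "p / q \<le> \<alpha>" and "\<alpha> \<le> 1"
    and "comp_op f \<in> lp_space p \<rightarrow> bv_space q"
  shows "holder_on_bounded_sets (lp_space p) (lp_norm p) (bv_space q) (bv_norm q) \<alpha> (comp_op f)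
    \<longleftrightarrow> holder_on_bounded_sets UNIV norm UNIV norm \<alpha> f"
proof -
  have pos: "0 < p" "0 < q"
    using assms by auto
  have "0 < \<alpha>"
    using pos \<open>p / q \<le> \<alpha>\<close> by (meson divide_pos_pos less_le_trans)
  have exponent: "p \<le> \<alpha> * q"
    using pos \<open>p / q \<le> \<alpha>\<close> by (simp add: pos_divide_le_eq)
  have "\<exists>L\<ge>0. \<forall>u v. norm u \<le> r \<longrightarrow> norm v \<le> r \<longrightarrow> norm (f u - f v) \<le> L * norm (u - v) powr \<alpha>"
    if "holder_on_bounded_sets (lp_space p) (lp_norm p) (bv_space q) (bv_norm q) \<alpha> (comp_op f)"
      and "0 < r" for r
  proof -
    obtain L where "0 \<le> L" and L: "\<And>x y. \<lbrakk>x \<in> lp_space p; y \<in> lp_space p;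
        lp_norm p x \<le> r; lp_norm p y \<le> r\<rbrakk> \<Longrightarrow>
        bv_norm q (comp_op f x - comp_op f y) \<le> L * lp_norm p (x - y) powr \<alpha>"
      using \<open>holder_on_bounded_sets _ _ _ _ _ _\<close> \<open>0 < r\<close>
      unfolding holder_on_bounded_sets_def by meson
    have "norm (f u - f v) \<le> L * norm (u - v) powr \<alpha>" if "norm u \<le> r" "norm v \<le> r" for u v
    proof -
      define e :: "'a \<Rightarrow> nat \<Rightarrow> 'a" where "e a = (\<lambda>n. if n = 0 then a else 0)" for a
      have e: "e a \<in> lp_space p" "lp_norm p (e a) = norm a" for a
        unfolding e_def using pos by (simp_all add: lp_single)
      \<comment> \<open>Only index 0 matters here, so the value of \<open>f\<close> at 0 is
        irrelevant.\<close>
      have "norm (f u - f v) = norm ((comp_op f (e u) - comp_op f (e v)) 0)"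
        by (simp add: comp_op_def e_def)
      also have "\<dots> \<le> bv_norm q (comp_op f (e u) - comp_op f (e v))"
        by (rule norm_le_bv_norm)
      also have "\<dots> \<le> L * lp_norm p (e u - e v) powr \<alpha>"
        using that by (intro L) (simp_all add: e)
      also have "e u - e v = e (u - v)"
        by (auto simp: e_def)
      finally show ?thesis
        by (simp add: e)
    qed
    then show ?thesis
      using \<open>0 \<le> L\<close> by blast
  qed
  moreover have "\<exists>L\<ge>0. \<forall>x\<in>lp_space p. \<forall>y\<in>lp_space p. lp_norm p x \<le> r \<longrightarrow> lp_norm p y \<le> r \<longrightarrow>
      bv_norm q (comp_op f x - comp_op f y) \<le> L * lp_norm p (x - y) powr \<alpha>"
    if "holder_on_bounded_sets UNIV norm UNIV norm \<alpha> f" and "0 < r" for r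
  proof -
    obtain L where "0 \<le> L" and L: "\<And>u v. \<lbrakk>norm u \<le> r; norm v \<le> r\<rbrakk> \<Longrightarrow>
        norm (f u - f v) \<le> L * norm (u - v) powr \<alpha>"
      using \<open>holder_on_bounded_sets _ _ _ _ _ _\<close> \<open>0 < r\<close>
      unfolding holder_on_bounded_sets_def by (meson UNIV_I)
    \<comment> \<open>The constant of \<open>bv_norm_le_lp_norm\<close>; it does not depend on
      \<open>r\<close>, which enters only through \<open>L\<close>.\<close>
    define c where "c = 1 + 2 * 2 powr (1/q)"
    have "0 \<le> c"
      by (simp add: c_def)
    have "bv_norm q (comp_op f x - comp_op f y) \<le> (c * L) * lp_norm p (x - y) powr \<alpha>"
      if "x \<in> lp_space p" "y \<in> lp_space p" "lp_norm p x \<le> r" "lp_norm p y \<le> r" for x y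
    proof -
      \<comment> \<open>The \<open>p\<close>-norm ball of radius \<open>r\<close> keeps all terms in
        the ball of radius \<open>r\<close> of the underlying space, so one \<open>L\<close> serves
        every index.\<close>
      have "norm (x n) \<le> r" "norm (y n) \<le> r" for n
        using that pos norm_le_lp_norm order_trans by blast+
      then have "norm ((comp_op f x - comp_op f y) n) \<le> L * norm ((x - y) n) powr \<alpha>" for n
        by (simp add: comp_op_def L)
      moreover have "x - y \<in> lp_space p"
        using that pos by (intro lp_space_diff) auto
      ultimately have "comp_op f x - comp_op f y \<in> lp_space q"
        and le: "lp_norm q (comp_op f x - comp_op f y) \<le> L * lp_norm p (x - y) powr \<alpha>"
        using lp_norm_holder_le pos exponent \<open>0 \<le> L\<close> by blast+
      then have "bv_norm q (comp_op f x - comp_op f y) \<le> c * lp_norm q (comp_op f x - comp_op f y)"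
        unfolding c_def using pos by (intro bv_norm_le_lp_norm)
      also have "\<dots> \<le> c * (L * lp_norm p (x - y) powr \<alpha>)"
        using le \<open>0 \<le> c\<close> by (rule mult_left_mono)
      finally show ?thesis
        by (simp add: mult.assoc)
    qed
    moreover have "0 \<le> c * L"
      using \<open>0 \<le> c\<close> \<open>0 \<le> L\<close> by simp
    ultimately show ?thesis
      by blast
  qed
  \<comment> \<open>The mapping condition in the definition is the assumption on
    \<open>comp_op f\<close> on one side and trivial on the other.\<close>
  ultimately show ?thesis
    using \<open>0 < \<alpha>\<close> \<open>\<alpha> \<le> 1\<close> \<open>comp_op f \<in> _\<close>
    by (subst (1 2) holder_on_bounded_sets_def) (auto simp: holder_on_bounded_sets_def)
qed

end
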